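(* Let $G=(V,E)$ be a connected threshold graph of size $n\ge 2$, $V=\{1,\dots,n\}$, and let $s$ be the number of distinct degrees of its nodes. Consider the network $\dot x=-L(G)x+Bu$ with input matrix $B=[e_{j_1},\ldots,e_{j_m}]$, where $V_C=\{j_1,\ldots,j_m\}\subseteq V$ is the set of control nodes. Let $\tilde d_1<\cdots<\tilde d_s$ be the distinct node degrees of $G$, and for $1\le i\le s$ let $K^{(i)}=\{j\in V: d(j)=\tilde d_i\}$. Then: (1) If $V_C$ is chosen by picking one node $k_i\in K^{(i)}$ (arbitrarily) for each $1\le i\le s$ and setting $V_C=V\setminus\{k_1,\ldots,k_s\}$, the network is controllable. (2) The minimum number of control nodes (the minimum of $|V_C|$ over all $V_C\subseteq V$) rendering the network controllable is $n-s$ (which is the size of the sets $V_C$ in (1)).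
   Context: All graphs are finite, undirected, unweighted and loop-free. $d(j)$ is the degree of node $j$. $L(G)=\Delta(G)-A(G)$ is the Laplacian matrix, with $\Delta(G)$ the diagonal matrix of node degrees and $A(G)$ the $(0,1)$-adjacency matrix. $e_j$ is the $j$-th column of the identity matrix $I_n$. A threshold graph of size $n$ is a graph obtained by starting from a single node and, in each of $n-1$ further steps, adding a new node which is either isolated (union) or adjacent to all previously added nodes (join). The network $\dot x=Ax+Bu$ with $A=-L(G)\in\mathbb{R}^{n\times n}$ and $B\in\mathbb{R}^{n\times m}$ is controllable in the usual sense of linear time-invariant systems (i.e. $\mathrm{rank}[B,AB,\ldots,A^{n-1}B]=n$). *)

theory Defs
  imports
    "Jordan_Normal_Form.DL_Rank"
    "Graph_Theory.Pair_Digraph"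
    "Graph_Theory.Digraph_Component"
begin

(* An undirected simple graph is a pair_graph: a finite, loop-free, symmetric set of arcs,
   in which each edge {u, v} is represented by the two arcs (u, v) and (v, u).
   Hence the out-degree of a node is its degree. *)

abbreviation deg :: "'a pair_pre_digraph \<Rightarrow> 'a \<Rightarrow> nat" where
  "deg G v \<equiv> out_degree (with_proj G) v"

(* Node labels are arbitrary: they need not follow the order of construction. *)
inductive threshold_graph :: "'a pair_pre_digraph \<Rightarrow> bool" where
  single: "threshold_graph \<lparr>pverts = {v}, parcs = {}\<rparr>"
| add_isolated: "threshold_graph G \<Longrightarrow> v \<notin> pverts G \<Longrightarrow>
    threshold_graph \<lparr>pverts = insert v (pverts G), parcs = parcs G\<rparr>"
| add_dominating: "threshold_graph G \<Longrightarrow> v \<notin> pverts G \<Longrightarrow>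
    threshold_graph \<lparr>pverts = insert v (pverts G),
                     parcs = parcs G \<union> {v} \<times> pverts G \<union> pverts G \<times> {v}\<rparr>"

lemma threshold_graph_imp_pair_graph: "threshold_graph G \<Longrightarrow> pair_graph G"
proof -
  assume "threshold_graph G"
  then have "finite (pverts G) \<and> parcs G \<subseteq> pverts G \<times> pverts G \<and> sym (parcs G) \<and>
    (\<forall>v. (v, v) \<notin> parcs G)"
    by induction (auto simp: sym_def)
  then show ?thesis
    by unfold_locales (auto simp: symmetric_def intro: finite_subset)
qed

(* The nodes of a graph on n nodes are numbered 0, ..., n - 1, matching the 0-based matrix indices. *)

definition adjacency_mat :: "nat \<Rightarrow> nat pair_pre_digraph \<Rightarrow> real mat" where
  "adjacency_mat n G = mat n n (\<lambda>(i, j). if (i, j) \<in> parcs G then 1 else 0)"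

definition degree_mat :: "nat \<Rightarrow> nat pair_pre_digraph \<Rightarrow> real mat" where
  "degree_mat n G = mat n n (\<lambda>(i, j). if i = j then real (deg G i) else 0)"

definition laplacian_mat :: "nat \<Rightarrow> nat pair_pre_digraph \<Rightarrow> real mat" where
  "laplacian_mat n G = degree_mat n G - adjacency_mat n G"

definition input_mat :: "nat \<Rightarrow> nat list \<Rightarrow> real mat" where
  "input_mat n js = mat_of_cols n (map (unit_vec n) js)"

(* The block matrix [B, AB, ..., A^(n-1) B]: if B has m columns, then column k is
   column (k mod m) of the block A^(k div m) B. *)
definition controllability_mat :: "nat \<Rightarrow> real mat \<Rightarrow> real mat \<Rightarrow> real mat" where
  "controllability_mat n A B =
     mat n (n * dim_col B)
       (\<lambda>(i, k). ((A ^\<^sub>m (k div dim_col B)) * B) $$ (i, k mod dim_col B))"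

definition controllable :: "nat \<Rightarrow> real mat \<Rightarrow> real mat \<Rightarrow> bool" where
  "controllable n A B \<longleftrightarrow> vec_space.rank n (controllability_mat n A B) = n"

end

theory Submission
  imports Defs "HOL-Computational_Algebra.Fundamental_Theorem_Algebra"
begin

text \<open>
  By symmetry of \<open>L\<close>, a row vector \<open>w\<close> annihilates the controllability matrix exactly when the
  vectors \<open>w, L w, \<dots>, L^(n-1) w\<close> all vanish on the control nodes, so controllability says that only
  \<open>w = 0\<close> has this property (\<open>controllable_symmetric_iff\<close>). Such a \<open>w\<close> yields an eigenvector: if
  \<open>p\<close> is the minimal polynomial of \<open>w\<close> and \<open>p = (X - l) q\<close> over the complex numbers, then
  \<open>u = q(L) w\<close> is a nonzero eigenvector that is a combination of the first \<open>n\<close> iterates, hence also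
  vanishes on the control nodes (\<open>krylov_eigenvector\<close>). The eigenvectors below
  are complex because \<open>l\<close> is a root supplied by algebraic closedness. Everything thus depends on where eigenvectors of \<open>L\<close>
  can be supported.

  Two nodes \<open>x, y\<close> of the same degree in a threshold graph have the same neighbours apart from
  each other, because neighbourhoods in a threshold graph are nested. Therefore \<open>e_x - e_y\<close> is an
  eigenvector of \<open>L\<close>, and every controllable choice leaves out at most one node of each
  degree. This gives the lower bound \<open>n - s\<close>.

  Conversely, let \<open>u\<close> be an eigenvector with eigenvalue \<open>l\<close> whose support contains at most one node
  of each degree. If \<open>l = 0\<close> then \<open>u\<close> is constant along edges, so a node of maximal degree \<open>D > 0\<close> in
  the support would have its whole closed neighbourhood in the support: \<open>D + 1\<close> nodes with pairwise
  distinct degrees in \<open>{1..D}\<close>, which is impossible. Hence the support consists of isolated nodes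
  (\<open>lap_kernel_support_isolated\<close>), and a connected graph with two nodes has none. If \<open>l \<noteq> 0\<close> then \<open>u\<close>
  has coordinate sum zero, and \<open>u = 0\<close> follows by induction on the construction of the graph
  (\<open>threshold_eigenvector_zero\<close>). On vectors of sum zero the Laplacian of the complement is
  \<open>n I - L\<close>, so the eigenvalue \<open>n\<close>, critical when a dominating node is added, reduces to the
  eigenvalue \<open>0\<close>, critical when an isolated node is added.
\<close>

section \<open>Controllability with a symmetric system matrix\<close>

text \<open>Padding with zero rows gives a square matrix with a vanishing row, whose determinant is zero.\<close>

lemma underdetermined_kernel:
  fixes M :: "'a :: field mat"
  assumes M: "M \<in> carrier_mat r n" and "r < n"
  shows "\<exists>w \<in> carrier_vec n. w \<noteq> 0\<^sub>v n \<and> M *\<^sub>v w = 0\<^sub>v r"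
proof -
  define P where "P = mat n n (\<lambda>(i, j). if i < r then M $$ (i, j) else 0)"
  have P: "P \<in> carrier_mat n n" by (simp add: P_def)
  have "P\<^sup>T *\<^sub>v unit_vec n r = 0\<^sub>v n"
    using \<open>r < n\<close> by (intro eq_vecI) (auto simp: P_def)
  moreover have "unit_vec n r \<noteq> (0\<^sub>v n :: 'a vec)"
    using \<open>r < n\<close> by (metis index_unit_vec(2) index_zero_vec(1) zero_neq_one)
  ultimately have "det P\<^sup>T = 0"
    using det_0_iff_vec_prod_zero_field[OF transpose_carrier_mat[THEN iffD2, OF P]] unit_vec_carrier by metis
  then have "det P = 0" using det_transpose[OF P] by simp
  then obtain w where w: "w \<in> carrier_vec n" "w \<noteq> 0\<^sub>v n" "P *\<^sub>v w = 0\<^sub>v n"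
    using det_0_iff_vec_prod_zero_field[OF P] by blast
  have "M *\<^sub>v w = 0\<^sub>v r"
  proof (intro eq_vecI)
    fix i assume i: "i < dim_vec (0\<^sub>v r :: 'a vec)"
    then have "i < n" using \<open>r < n\<close> by simp
    have "row P i = row M i"
      using i M \<open>r < n\<close> by (intro eq_vecI) (auto simp: P_def)
    then have "(M *\<^sub>v w) $ i = (P *\<^sub>v w) $ i"
      using i M P \<open>r < n\<close> by simp
    then show "(M *\<^sub>v w) $ i = 0\<^sub>v r $ i" using w i \<open>i < n\<close> by simp
  qed (use M in simp)
  with w show ?thesis by blast
qed

text \<open>
  Both directions are read off a maximal independent set \<open>S\<close> of columns, which spans the same space
  and has the same annihilator as all the columns: taken as rows, \<open>S\<close> is a nonsingular square matrix
  if it has \<open>n\<close> elements, and an underdetermined system if it has fewer.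
\<close>

lemma full_row_rank_iff:
  fixes M :: "'a :: field mat"
  assumes M: "M \<in> carrier_mat n N"
  shows "vec_space.rank n M = n \<longleftrightarrow>
    (\<forall>w \<in> carrier_vec n. (\<forall>k < N. w \<bullet> col M k = 0) \<longrightarrow> w = 0\<^sub>v n)"
proof -
  interpret vec_space "TYPE('a)" n .
  obtain S where S: "maximal S (\<lambda>T. T \<subseteq> set (cols M) \<and> lin_indpt T)"
    using maximal_exists_superset[of "set (cols M)" "\<lambda>T. T \<subseteq> set (cols M) \<and> lin_indpt T" "{}"]
      finite_lin_indpt2 by auto
  have rank: "rank M = card S" using rank_card_indpt[OF M S] .
  have indep: "lin_indpt S" and sub: "S \<subseteq> set (cols M)" using S by (auto simp: maximal_def)
  have colsM: "set (cols M) \<subseteq> carrier_vec n" using cols_dim[of M] M by simp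
  have Sc: "S \<subseteq> carrier_vec n" using sub colsM by simp
  obtain bs where bs: "set bs = S" "distinct bs"
    using finite_distinct_list finite_subset[OF sub] by auto
  have len: "length bs = card S" using bs distinct_card by fastforce
  define Q where "Q = mat_of_rows n bs"
  have Q: "Q \<in> carrier_mat (card S) n" by (simp add: Q_def len[symmetric])
  have Qw: "Q *\<^sub>v w = 0\<^sub>v (card S) \<longleftrightarrow> (\<forall>b \<in> S. b \<bullet> w = 0)" for w
  proof -
    have "row Q i = bs ! i" if "i < card S" for i
      using that Sc bs len unfolding Q_def by (intro mat_of_rows_row) auto
    then have "(Q *\<^sub>v w) $ i = bs ! i \<bullet> w" if "i < card S" for i
      using that Q by simp
    then have "Q *\<^sub>v w = 0\<^sub>v (card S) \<longleftrightarrow> (\<forall>i < card S. bs ! i \<bullet> w = 0)"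
      using Q by (simp add: vec_eq_iff)
    also have "\<dots> \<longleftrightarrow> (\<forall>b \<in> S. b \<bullet> w = 0)"
      using len bs by (metis in_set_conv_nth)
    finally show ?thesis .
  qed
  have cols_iff: "(\<forall>k < N. w \<bullet> col M k = 0) \<longleftrightarrow> (\<forall>c \<in> set (cols M). w \<bullet> c = 0)" for w
    using M by (auto simp: cols_def)
  have ann: "(\<forall>k < N. w \<bullet> col M k = 0) \<longleftrightarrow> (\<forall>b \<in> S. b \<bullet> w = 0)" if w: "w \<in> carrier_vec n" for w
  proof
    assume "\<forall>k < N. w \<bullet> col M k = 0"
    then show "\<forall>b \<in> S. b \<bullet> w = 0"
      using cols_iff sub Sc w comm_scalar_prod by (metis subsetD)
  next
    assume b0: "\<forall>b \<in> S. b \<bullet> w = 0"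
    have "w \<bullet> c = 0" if c: "c \<in> set (cols M)" for c
    proof -
      have "c \<in> span S"
      proof (rule ccontr)
        assume n: "c \<notin> span S"
        have "c \<notin> S" using n span_mem[of S c] Sc by auto
        then have "lin_indpt (S \<union> {c})"
          using lin_dep_iff_in_span[of S c] indep n Sc c colsM by auto
        moreover have "S \<union> {c} \<subseteq> set (cols M)" using sub c by auto
        ultimately have "S \<union> {c} = S" using S unfolding maximal_def by blast
        with \<open>c \<notin> S\<close> show False by auto
      qed
      then obtain a where c_eq: "c = lincomb a S"
        using finite_in_span[of S c] Sc sub finite_subset by (metis List.finite_set)
      have "w \<bullet> c = (\<Sum>i<n. w $ i * (\<Sum>b\<in>S. a b * b $ i))"
        using c colsM Sc unfolding scalar_prod_def
        by (auto simp: c_eq lincomb_dim[OF finite_subset[OF sub] Sc] lincomb_index[OF _ Sc] atLeast0LessThan)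
      also have "\<dots> = (\<Sum>b\<in>S. a b * (\<Sum>i<n. b $ i * w $ i))"
        unfolding sum_distrib_left
        by (subst sum.swap) (simp add: ac_simps)
      also have "\<dots> = (\<Sum>b\<in>S. a b * (b \<bullet> w))"
        using w by (simp add: scalar_prod_def atLeast0LessThan)
      also have "\<dots> = 0" using b0 by simp
      finally show ?thesis .
    qed
    then show "\<forall>k < N. w \<bullet> col M k = 0" using cols_iff by blast
  qed
  have "card S = n \<longleftrightarrow> (\<forall>w \<in> carrier_vec n. Q *\<^sub>v w = 0\<^sub>v (card S) \<longrightarrow> w = 0\<^sub>v n)"
  proof
    assume n: "card S = n"
    have "rank Q\<^sup>T = n"
    proof -
      have "Q\<^sup>T \<in> carrier_mat n n" using Q n by simp
      moreover have "cols Q\<^sup>T = bs"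
        unfolding Q_def transpose_mat_of_rows using Sc bs by (intro cols_mat_of_cols) simp
      ultimately show ?thesis using lin_indpt_full_rank bs indep by metis
    qed
    then have "det Q \<noteq> 0" using det_rank_iff[of "Q\<^sup>T"] Q n det_transpose[of Q n] by simp
    then show "\<forall>w \<in> carrier_vec n. Q *\<^sub>v w = 0\<^sub>v (card S) \<longrightarrow> w = 0\<^sub>v n"
      using det_0_iff_vec_prod_zero_field[of Q n] Q n by auto
  next
    assume inj: "\<forall>w \<in> carrier_vec n. Q *\<^sub>v w = 0\<^sub>v (card S) \<longrightarrow> w = 0\<^sub>v n"
    have "card S \<le> n"
      using li_le_dim(2)[OF fin_dim _ indep] Sc dim_is_n by simp
    moreover have "\<not> card S < n" using underdetermined_kernel[OF Q] inj by blast
    ultimately show "card S = n" by simp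
  qed
  then show ?thesis using rank ann Qw by auto
qed

text \<open>
  The vectors \<open>g 0, g 1, \<dots>\<close> are the iterates of the matrix \<open>M\<close> on \<open>g 0\<close>. The last conclusion records
  that the eigenvector is a combination of the first \<open>n\<close> iterates, in the form needed below:
  it vanishes at every coordinate at which they all vanish.
\<close>

lemma krylov_eigenvector:
  fixes M :: "nat \<Rightarrow> nat \<Rightarrow> complex" and g :: "nat \<Rightarrow> nat \<Rightarrow> complex"
  assumes step: "\<And>k i. i < n \<Longrightarrow> g (Suc k) i = (\<Sum>j<n. M i j * g k j)"
    and nz: "i0 < n" "g 0 i0 \<noteq> 0"
  shows "\<exists>l u. (\<exists>i<n. u i \<noteq> 0) \<and> (\<forall>i<n. (\<Sum>j<n. M i j * u j) = l * u i)
    \<and> (\<forall>i. (\<forall>k<n. g k i = 0) \<longrightarrow> u i = 0)"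
proof -
  define ev where "ev p i = (\<Sum>k\<le>n. coeff p k * g k i)" for p :: "complex poly" and i
  \<comment> \<open>\<open>ev p\<close> is the vector \<open>p(M) (g 0)\<close>; the annihilating \<open>p\<close> of least degree is the minimal polynomial.\<close>
  define ann where "ann p \<longleftrightarrow> p \<noteq> 0 \<and> degree p \<le> n \<and> (\<forall>i<n. ev p i = 0)" for p
  have "\<exists>p. ann p"
  proof -
    \<comment> \<open>The \<open>n + 1\<close> vectors \<open>g 0, \<dots>, g n\<close> in dimension \<open>n\<close> are linearly dependent.\<close>
    define D where "D = mat n (Suc n) (\<lambda>(i, k). g k i)"
    obtain c where c: "c \<in> carrier_vec (Suc n)" "c \<noteq> 0\<^sub>v (Suc n)" "D *\<^sub>v c = 0\<^sub>v n"
      using underdetermined_kernel[of D n "Suc n"] by (auto simp: D_def)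
    define p where "p = Poly (list_of_vec c)"
    have coeff_p: "coeff p k = c $ k" if "k \<le> n" for k
      using that c by (simp add: p_def nth_default_def)
    have "p \<noteq> 0"
    proof
      assume "p = 0"
      then have "c = 0\<^sub>v (Suc n)" using coeff_p c(1) by (intro eq_vecI) auto
      with c(2) show False by simp
    qed
    moreover have "degree p \<le> n"
      using c(1) by (intro degree_le) (auto simp: p_def nth_default_def)
    moreover have "ev p i = 0" if i: "i < n" for i
    proof -
      have "ev p i = (D *\<^sub>v c) $ i"
        using i c(1) by (simp add: ev_def D_def scalar_prod_def coeff_p atLeast0LessThan
            lessThan_Suc_atMost mult.commute)
      then show ?thesis using c(3) i by simp
    qed
    ultimately show ?thesis unfolding ann_def by blast
  qed
  then obtain p where p: "ann p" and min: "\<And>q. ann q \<Longrightarrow> degree p \<le> degree q"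
    using ex_has_least_nat[of ann _ degree] by blast
  have "degree p \<noteq> 0"
  proof
    assume d: "degree p = 0"
    then obtain c where c: "p = [:c:]" using degree_eq_zeroE by blast
    then have "ev p i0 = c * g 0 i0"
      by (simp add: ev_def sum.atMost_shift coeff_pCons)
    then show False using p nz c by (simp add: ann_def)
  qed
  then obtain l where "poly p l = 0"
    using fundamental_theorem_of_algebra[of p] by (auto simp: constant_degree)
  then obtain q where pq: "p = [:- l, 1:] * q" using poly_eq_0_iff_dvd by blast
  have q0: "q \<noteq> 0" using p pq by (auto simp: ann_def)
  have deg: "degree p = Suc (degree q)" unfolding pq using q0 by (subst degree_mult_eq) auto
  \<comment> \<open>By minimality \<open>q\<close> does not annihilate, so \<open>ev q\<close> is nonzero, while \<open>(M - l) (ev q) = ev p = 0\<close>.\<close>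
  then have "\<not> ann q" using min by force
  then have nonzero: "\<exists>i<n. ev q i \<noteq> 0" using q0 p deg by (auto simp: ann_def)
  have qn: "coeff q k = 0" if "n \<le> k" for k
    using that deg p by (intro coeff_eq_0) (auto simp: ann_def)
  have "(\<Sum>j<n. M i j * ev q j) = l * ev q i" if i: "i < n" for i
  proof -
    have "(\<Sum>j<n. M i j * ev q j) = (\<Sum>k\<le>n. coeff q k * (\<Sum>j<n. M i j * g k j))"
      unfolding ev_def sum_distrib_left by (subst sum.swap) (simp add: ac_simps)
    also have "\<dots> = (\<Sum>k\<le>n. coeff q k * g (Suc k) i)" using step i by simp
    also have "\<dots> = (\<Sum>k\<le>Suc n. coeff (pCons 0 q) k * g k i)"
      by (simp add: sum.atMost_Suc_shift del: sum.atMost_Suc)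
    also have "\<dots> = (\<Sum>k\<le>n. coeff (pCons 0 q) k * g k i)" using qn by simp
    finally have "(\<Sum>j<n. M i j * ev q j) - l * ev q i
        = (\<Sum>k\<le>n. (coeff (pCons 0 q) k - l * coeff q k) * g k i)"
      by (simp add: ev_def sum_distrib_left sum_subtractf algebra_simps)
    also have "\<dots> = ev p i" by (simp add: ev_def pq)
    also have "\<dots> = 0" using p i by (simp add: ann_def)
    finally show ?thesis by simp
  qed
  moreover have "ev q i = 0" if "\<forall>k<n. g k i = 0" for i
    unfolding ev_def using that qn by (intro sum.neutral) (metis atMost_iff leI mult_zero_left mult_zero_right)
  ultimately show ?thesis using nonzero by (intro exI[of _ l] exI[of _ "ev q"]) blast
qed

lemma symmetric_pow_scalar_prod:
  fixes A :: "'a :: comm_ring_1 mat"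
  assumes A: "A \<in> carrier_mat n n" "A\<^sup>T = A" and w: "w \<in> carrier_vec n"
  shows "u \<in> carrier_vec n \<Longrightarrow> w \<bullet> (A ^\<^sub>m k *\<^sub>v u) = (((*\<^sub>v) A) ^^ k) w \<bullet> u"
proof (induction k arbitrary: u)
  case 0
  then show ?case using A by simp
next
  case (Suc k)
  have it: "(((*\<^sub>v) A) ^^ k) w \<in> carrier_vec n"
    by (induction k) (use A w in auto)
  have "w \<bullet> (A ^\<^sub>m Suc k *\<^sub>v u) = w \<bullet> (A ^\<^sub>m k *\<^sub>v (A *\<^sub>v u))"
    using A Suc.prems by (simp add: assoc_mult_mat_vec[of _ n n _ n])
  also have "\<dots> = (((*\<^sub>v) A) ^^ k) w \<bullet> (A *\<^sub>v u)" using Suc A by simp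
  also have "\<dots> = (A *\<^sub>v (((*\<^sub>v) A) ^^ k) w) \<bullet> u"
    using transpose_vec_mult_scalar[OF A(1) Suc.prems it] A(2) by simp
  finally show ?case by simp
qed

text \<open>
  Symmetry turns the pairing of \<open>w\<close> with the column \<open>A^k e_j\<close> of the controllability matrix into the
  \<open>j\<close>-th coordinate of \<open>A^k w\<close>.
\<close>

lemma controllable_symmetric_iff:
  assumes A: "A \<in> carrier_mat n n" "A\<^sup>T = A" and js: "set js \<subseteq> {..<n}"
  shows "controllable n A (input_mat n js) \<longleftrightarrow>
    (\<forall>w \<in> carrier_vec n. (\<forall>k<n. \<forall>j\<in>set js. ((((*\<^sub>v) A) ^^ k) w) $ j = 0) \<longrightarrow> w = 0\<^sub>v n)"
proof -
  define B where "B = input_mat n js"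
  define m where "m = length js"
  have B: "B \<in> carrier_mat n m" 
    using mat_of_cols_carrier(1)[of n "map (unit_vec n) js"] by (simp add: B_def m_def input_mat_def)
  have colB: "col B b = unit_vec n (js ! b)" if "b < m" for b
    using that by (simp add: B_def m_def input_mat_def)
  let ?C = "controllability_mat n A B"
  have C: "?C \<in> carrier_mat n (n * m)" using B by (simp add: controllability_mat_def)
  have colC: "col ?C (a * m + b) = A ^\<^sub>m a *\<^sub>v unit_vec n (js ! b)" if ab: "a < n" "b < m" for a b
  proof -
    have "Suc a * m \<le> n * m" using ab by (intro mult_le_mono1) simp
    then have "a * m + b < n * m" using ab by simp
    moreover have "(a * m + b) div m = a" "(a * m + b) mod m = b" using ab by auto
    ultimately show ?thesis
      using ab A B colB[OF ab(2)] by (intro eq_vecI) (auto simp: controllability_mat_def)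
  qed
  have "(\<forall>k < n * m. w \<bullet> col ?C k = 0) \<longleftrightarrow> (\<forall>k<n. \<forall>j\<in>set js. ((((*\<^sub>v) A) ^^ k) w) $ j = 0)"
    if w: "w \<in> carrier_vec n" for w
  proof -
    have entry: "w \<bullet> col ?C (a * m + b) = ((((*\<^sub>v) A) ^^ a) w) $ (js ! b)" if ab: "a < n" "b < m" for a b
    proof -
      have "js ! b < n" using js ab by (auto simp: m_def dest: nth_mem)
      then show ?thesis
        using colC[OF ab] symmetric_pow_scalar_prod[OF A w] by simp
    qed
    show ?thesis
    proof
      assume L: "\<forall>k < n * m. w \<bullet> col ?C k = 0"
      show "\<forall>k<n. \<forall>j\<in>set js. ((((*\<^sub>v) A) ^^ k) w) $ j = 0"
      proof (intro allI impI ballI)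
        fix a j assume a: "a < n" and "j \<in> set js"
        then obtain b where b: "b < m" "j = js ! b" by (auto simp: in_set_conv_nth m_def)
        have "Suc a * m \<le> n * m" using a by (intro mult_le_mono1) simp
        then have "a * m + b < n * m" using b by simp
        then show "((((*\<^sub>v) A) ^^ a) w) $ j = 0" using L entry[OF a b(1)] b(2) by metis
      qed
    next
      assume R: "\<forall>k<n. \<forall>j\<in>set js. ((((*\<^sub>v) A) ^^ k) w) $ j = 0"
      show "\<forall>k < n * m. w \<bullet> col ?C k = 0"
      proof (intro allI impI)
        fix k assume k: "k < n * m"
        then have "m > 0" by (cases m) auto
        have "k div m < n" "k mod m < m" using k \<open>m > 0\<close> by (auto simp: less_mult_imp_div_less)
        with entry[OF this] R show "w \<bullet> col ?C k = 0" by (auto simp: m_def)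
      qed
    qed
  qed
  then show ?thesis
    using full_row_rank_iff[OF C] unfolding controllable_def B_def[symmetric] by auto
qed


section \<open>Kernel and top eigenvectors of the Laplacian\<close>

text \<open>
  The Laplacian as an operator on functions on the nodes. It takes only the edge relation, and thus
  stays the same when an isolated node is added.
\<close>

definition lap :: "('a \<times> 'a) set \<Rightarrow> ('a \<Rightarrow> 'b) \<Rightarrow> 'a \<Rightarrow> 'b :: ab_group_add" where
  "lap E v x = (\<Sum>y\<in>E `` {x}. v x - v y)"

lemma finite_neighbours:
  assumes "finite V" "E \<subseteq> V \<times> V"
  shows "finite (E `` {x})"
  using assms by (meson Image_singleton_iff SigmaD2 finite_subset subset_iff)

text \<open>
  Summation by parts: the bilinear form of the Laplacian is a sum over edges. Each undirected edge
  contributes two arcs, hence the factor \<open>2\<close>.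
\<close>

lemma lap_symmetric_sum:
  fixes v :: "'a \<Rightarrow> complex"
  assumes "finite V" "E \<subseteq> V \<times> V" "sym E"
  shows "2 * (\<Sum>x\<in>V. lap E v x * f x) = (\<Sum>(x, y)\<in>E. (v x - v y) * (f x - f y))"
proof -
  have E: "E = Sigma V (\<lambda>x. E `` {x})" using assms(2) by auto
  have fin: "finite (E `` {x})" for x
    using assms(1,2) by (rule finite_neighbours)
  have 1: "(\<Sum>x\<in>V. lap E v x * f x) = (\<Sum>(x, y)\<in>E. (v x - v y) * f x)"
    by (subst (2) E, subst sum.Sigma[symmetric])
      (use assms(1) fin in \<open>auto simp: lap_def sum_distrib_right\<close>)
  have "(\<Sum>(x, y)\<in>E. (v x - v y) * f x) = (\<Sum>(x, y)\<in>E. (v y - v x) * f y)"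
    using assms(3) by (intro sum.reindex_bij_witness[of _ prod.swap prod.swap]) (auto dest: symD)
  then have "(\<Sum>(x, y)\<in>E. (v x - v y) * f x) + (\<Sum>(x, y)\<in>E. (v x - v y) * f x)
      = (\<Sum>(x, y)\<in>E. (v x - v y) * f x + (v y - v x) * f y)"
    by (simp add: sum.distrib case_prod_beta)
  also have "\<dots> = (\<Sum>(x, y)\<in>E. (v x - v y) * (f x - f y))"
    by (intro sum.cong) (auto simp: algebra_simps)
  finally show ?thesis by (simp only: mult_2 1)
qed

lemma sum_lap:
  fixes v :: "'a \<Rightarrow> complex"
  assumes "finite V" "E \<subseteq> V \<times> V" "sym E"
  shows "(\<Sum>x\<in>V. lap E v x) = 0"
  using lap_symmetric_sum[OF assms, of v "\<lambda>_. 1"] by (simp add: case_prod_beta)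

text \<open>The Hermitian form of \<open>v\<close> is the sum of the squared differences \<open>|v x - v y|^2\<close> over all arcs.\<close>

lemma lap_kernel_constant_on_edges:
  fixes v :: "'a \<Rightarrow> complex"
  assumes "finite V" "E \<subseteq> V \<times> V" "sym E"
    and "\<forall>x\<in>V. lap E v x = 0" and "(x, y) \<in> E"
  shows "v x = v y"
proof -
  have finE: "finite E" using assms(1,2) finite_subset by blast
  have "(\<Sum>(x, y)\<in>E. (v x - v y) * (cnj (v x) - cnj (v y))) = 0"
    using lap_symmetric_sum[OF assms(1-3), of v "\<lambda>x. cnj (v x)"] assms(4) by simp
  moreover have "(v x - v y) * (cnj (v x) - cnj (v y)) = of_real ((cmod (v x - v y))\<^sup>2)" for x y
    unfolding complex_norm_square by simp
  ultimately have "of_real (\<Sum>(x, y)\<in>E. (cmod (v x - v y))\<^sup>2) = (0 :: complex)"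
    by (simp add: case_prod_beta)
  then have "(\<Sum>(x, y)\<in>E. (cmod (v x - v y))\<^sup>2) = 0" unfolding of_real_eq_0_iff .
  then have "\<forall>e\<in>E. (case e of (x, y) \<Rightarrow> (cmod (v x - v y))\<^sup>2) = 0"
    by (subst (asm) sum_nonneg_eq_0_iff) (use finE in auto)
  then show ?thesis using assms(5) by auto
qed

text \<open>
  Otherwise a node \<open>m\<close> of maximal degree \<open>D > 0\<close> in the support passes its nonzero value on to all its
  neighbours, so \<open>D + 1\<close> nodes of the support have pairwise distinct degrees between \<open>1\<close> and \<open>D\<close>.
\<close>

lemma lap_kernel_support_isolated:
  fixes v :: "'a \<Rightarrow> complex"
  assumes "finite V" "E \<subseteq> V \<times> V" "sym E" "irrefl E"
    and ker: "\<forall>x\<in>V. lap E v x = 0"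
    and inj: "inj_on (\<lambda>x. card (E `` {x})) {x \<in> V. v x \<noteq> 0}"
    and x: "x \<in> V" "v x \<noteq> 0"
  shows "E `` {x} = {}"
proof (rule ccontr)
  assume ne: "E `` {x} \<noteq> {}"
  define S where "S = {x \<in> V. v x \<noteq> 0}"
  let ?d = "\<lambda>x. card (E `` {x})"
  have finS: "finite S" using assms(1) by (simp add: S_def)
  have fin: "finite (E `` {x})" for x
    using assms(1,2) by (rule finite_neighbours)
  have "Max (?d ` S) \<in> ?d ` S" using finS x by (intro Max_in) (auto simp: S_def)
  then obtain m where m: "m \<in> S" "?d m = Max (?d ` S)" by auto
  have le: "?d y \<le> ?d m" if "y \<in> S" for y using m(2) finS that by simp
  have "?d x > 0" using ne fin by (simp add: card_gt_0_iff)
  then have "?d m > 0" using le[of x] x by (simp add: S_def)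
  have nbr: "y \<in> S" if "y \<in> E `` {m}" for y
    using lap_kernel_constant_on_edges[OF assms(1-3) ker, of m y] that m(1) assms(2) by (auto simp: S_def)
  let ?N = "insert m (E `` {m})"
  have NS: "?N \<subseteq> S" using nbr m(1) by auto
  have "?d y \<in> {1..?d m}" if "y \<in> ?N" for y
  proof -
    have "E `` {y} \<noteq> {}" using that \<open>?d m > 0\<close> assms(3) by (auto dest: symD)
    then have "?d y > 0" using fin by (simp add: card_gt_0_iff)
    then show ?thesis using le NS that by auto
  qed
  moreover have "inj_on ?d ?N" using inj NS inj_on_subset unfolding S_def by blast
  ultimately have "card ?N \<le> card {1..?d m}" by (intro card_inj_on_le) auto
  moreover have "card ?N = Suc (?d m)"
    using fin assms(4) by (simp add: irrefl_def)
  ultimately show False by simp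
qed

text \<open>
  The support consists of isolated nodes, and all of these have degree \<open>0\<close>. So the support has at
  most one element, which the vanishing sum excludes.
\<close>

lemma lap_kernel_zero:
  fixes v :: "'a \<Rightarrow> complex"
  assumes "finite V" "E \<subseteq> V \<times> V" "sym E" "irrefl E"
    and "\<forall>x\<in>V. lap E v x = 0"
    and inj: "inj_on (\<lambda>x. card (E `` {x})) {x \<in> V. v x \<noteq> 0}"
    and sum: "(\<Sum>x\<in>V. v x) = 0"
    and x: "x \<in> V"
  shows "v x = 0"
proof (rule ccontr)
  assume vx: "v x \<noteq> 0"
  have iso: "E `` {y} = {}" if "y \<in> V" "v y \<noteq> 0" for y
    using lap_kernel_support_isolated[OF assms(1-6) that] .
  have "v y = 0" if y: "y \<in> V" "y \<noteq> x" for y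
  proof (rule ccontr)
    assume "v y \<noteq> 0"
    then have "y = x" using inj_onD[OF inj, of y x] iso x vx y by simp
    with y show False by simp
  qed
  then have "(\<Sum>x\<in>V. v x) = v x"
    using assms(1) x by (subst sum.remove[of _ x]) auto
  with sum vx show False by simp
qed

lemma lap_complement:
  fixes v :: "'a \<Rightarrow> complex"
  assumes "finite V" "E \<subseteq> V \<times> V" "irrefl E" and x: "x \<in> V"
  defines "C \<equiv> {(x, y) \<in> V \<times> V. x \<noteq> y \<and> (x, y) \<notin> E}"
  shows "lap C v x = of_nat (card V) * v x - (\<Sum>y\<in>V. v y) - lap E v x"
    and "card (C `` {x}) = card V - 1 - card (E `` {x})"
proof -
  have sub: "E `` {x} \<subseteq> V - {x}" using assms(2,3) by (auto simp: irrefl_def)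
  have C: "C `` {x} = V - {x} - E `` {x}" using x by (auto simp: C_def)
  have "lap C v x = (\<Sum>y\<in>V - {x}. v x - v y) - lap E v x"
    unfolding lap_def C using assms(1) sub by (subst sum_diff) auto
  also have "(\<Sum>y\<in>V - {x}. v x - v y) = (\<Sum>y\<in>V. v x - v y)"
    using assms(1) x by (simp add: sum.remove[of V x])
  finally show "lap C v x = of_nat (card V) * v x - (\<Sum>y\<in>V. v y) - lap E v x"
    by (simp add: sum_subtractf)
  show "card (C `` {x}) = card V - 1 - card (E `` {x})"
    unfolding C using assms(1) x sub by (subst card_Diff_subset) (auto intro: finite_subset)
qed

text \<open>
  A vector of sum zero with the eigenvalue \<open>card V\<close> lies in the kernel of the Laplacian of the
  complement graph, and complementation preserves distinctness of degrees.
\<close>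

lemma lap_top_eigenvector_zero:
  fixes v :: "'a \<Rightarrow> complex"
  assumes "finite V" "E \<subseteq> V \<times> V" "sym E" "irrefl E"
    and eig: "\<forall>x\<in>V. lap E v x = of_nat (card V) * v x"
    and inj: "inj_on (\<lambda>x. card (E `` {x})) {x \<in> V. v x \<noteq> 0}"
    and sum: "(\<Sum>x\<in>V. v x) = 0"
    and x: "x \<in> V"
  shows "v x = 0"
proof -
  define C where "C = {(x, y) \<in> V \<times> V. x \<noteq> y \<and> (x, y) \<notin> E}"
  note compl = lap_complement[OF assms(1,2,4), folded C_def]
  have bound: "card (E `` {y}) \<le> card V - 1" if "y \<in> V" for y
    using card_mono[of "V - {y}" "E `` {y}"] assms(1,2,4) that by (auto simp: irrefl_def)
  show ?thesis
  proof (rule lap_kernel_zero[of V C])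
    show "sym C" using assms(3) by (auto simp: C_def sym_def)
    show "inj_on (\<lambda>x. card (C `` {x})) {x \<in> V. v x \<noteq> 0}"
    proof (rule inj_onI)
      fix y z assume yz: "y \<in> {x \<in> V. v x \<noteq> 0}" "z \<in> {x \<in> V. v x \<noteq> 0}"
        and "card (C `` {y}) = card (C `` {z})"
      then have "card (E `` {y}) = card (E `` {z})"
        using compl(2)[of y] compl(2)[of z] bound[of y] bound[of z] by simp
      then show "y = z" using inj_onD[OF inj _ yz] by simp
    qed
  qed (use assms compl in \<open>auto simp: C_def irrefl_def\<close>)
qed

section \<open>Eigenvectors and twins in threshold graphs\<close>

lemma threshold_graph_simple:
  assumes "threshold_graph G"
  shows "finite (pverts G)" "parcs G \<subseteq> pverts G \<times> pverts G" "sym (parcs G)" "irrefl (parcs G)"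
  using assms by (induction) (auto simp: sym_def irrefl_def)

text \<open>
  The equation at the last node \<open>u\<close> reads \<open>l * v u = 0\<close> if \<open>u\<close> is isolated, and, as \<open>v\<close> has sum zero,
  \<open>l * v u = N * v u\<close> with \<open>N\<close> the number of nodes if \<open>u\<close> is dominating. Except for the one critical
  eigenvalue, \<open>v\<close> vanishes at \<open>u\<close> and restricts to an eigenvector of the smaller graph,
  for the eigenvalue \<open>l\<close> or \<open>l - 1\<close>. The sum condition, unlike connectedness, is inherited by the
  smaller graph.
\<close>

lemma threshold_eigenvector_zero:
  fixes v :: "'a \<Rightarrow> complex"
  assumes "threshold_graph G"
    and "\<forall>x\<in>pverts G. lap (parcs G) v x = l * v x"
    and "inj_on (\<lambda>x. card (parcs G `` {x})) {x \<in> pverts G. v x \<noteq> 0}"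
    and "(\<Sum>x\<in>pverts G. v x) = 0"
  shows "\<forall>x\<in>pverts G. v x = 0"
  using assms
proof (induction arbitrary: l)
  case (single u)
  then show ?case by simp
next
  case (add_isolated G u)
  let ?V = "pverts G" and ?E = "parcs G"
  note simple = threshold_graph_simple[OF add_isolated.hyps(1)]
  have eig: "\<forall>x\<in>insert u ?V. lap ?E v x = l * v x"
    and inj: "inj_on (\<lambda>x. card (?E `` {x})) {x \<in> insert u ?V. v x \<noteq> 0}"
    and sum: "(\<Sum>x\<in>insert u ?V. v x) = 0"
    using add_isolated.prems by simp_all
  show ?case
  proof (cases "l = 0")
    case True
    have "v x = 0" if "x \<in> insert u ?V" for x
      by (rule lap_kernel_zero[of "insert u ?V" ?E])
        (use simple eig inj sum that True in auto)
    then show ?thesis by simp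
  next
    case False
    have "?E `` {u} = {}" using simple(2) add_isolated.hyps(2) by auto
    then have "v u = 0" using eig False by (simp add: lap_def)
    moreover have "\<forall>x\<in>?V. v x = 0"
    proof (rule add_isolated.IH)
      show "inj_on (\<lambda>x. card (?E `` {x})) {x \<in> ?V. v x \<noteq> 0}"
        using inj by (rule inj_on_subset) auto
      show "(\<Sum>x\<in>?V. v x) = 0" using sum \<open>v u = 0\<close> simple(1) add_isolated.hyps(2) by simp
    qed (use eig in auto)
    ultimately show ?thesis by simp
  qed
next
  case (add_dominating G u)
  let ?V = "pverts G" and ?E = "parcs G"
  let ?W = "insert u ?V" and ?F = "parcs G \<union> {u} \<times> pverts G \<union> pverts G \<times> {u}"
  note simple = threshold_graph_simple[OF add_dominating.hyps(1)]
  note simple' = threshold_graph_simple[OF threshold_graph.add_dominating[OF add_dominating.hyps],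
      simplified]
  have u: "u \<notin> ?V" by (rule add_dominating.hyps)
  have eig: "\<forall>x\<in>?W. lap ?F v x = l * v x"
    and inj: "inj_on (\<lambda>x. card (?F `` {x})) {x \<in> ?W. v x \<noteq> 0}"
    and sum: "(\<Sum>x\<in>?W. v x) = 0"
    using add_dominating.prems by simp_all
  have fin: "finite (?E `` {x})" for x
    using simple(1,2) by (rule finite_neighbours)
  show ?case
  proof (cases "l = of_nat (card ?W)")
    case True
    have "v x = 0" if "x \<in> ?W" for x
      by (rule lap_top_eigenvector_zero[of ?W ?F])
        (use simple' simple eig inj sum that True in \<open>auto simp: sym_def irrefl_def\<close>)
    then show ?thesis by simp
  next
    case False
    have "?F `` {u} = ?V" using simple(2) u by auto
    then have "lap ?F v u = of_nat (card ?V) * v u - (\<Sum>x\<in>?V. v x)"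
      by (simp add: lap_def sum_subtractf)
    also have "\<dots> = of_nat (card ?W) * v u - (\<Sum>x\<in>?W. v x)"
      using u simple(1) by (simp add: algebra_simps)
    finally have "lap ?F v u = of_nat (card ?W) * v u" by (simp only: sum diff_zero)
    moreover have "lap ?F v u = l * v u" using eig by blast
    ultimately have "l * v u = of_nat (card ?W) * v u" by (rule trans[OF sym, rotated])
    then have vu: "v u = 0" using False mult_right_cancel[of "v u" l "of_nat (card ?W)"] by blast
    have nbr: "?F `` {x} = insert u (?E `` {x})" "u \<notin> ?E `` {x}" if "x \<in> ?V" for x
      using that u simple(2) by auto
    have "\<forall>x\<in>?V. v x = 0"
    proof (rule add_dominating.IH)
      show "\<forall>x\<in>?V. lap ?E v x = (l - 1) * v x"
      proof
        fix x assume x: "x \<in> ?V"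
        have "lap ?F v x = v x + lap ?E v x"
          unfolding lap_def nbr(1)[OF x] using fin nbr(2)[OF x] vu by simp
        then show "lap ?E v x = (l - 1) * v x" using eig x by (simp add: algebra_simps)
      qed
      show "inj_on (\<lambda>x. card (?E `` {x})) {x \<in> ?V. v x \<noteq> 0}"
      proof (rule inj_onI)
        fix x y assume xy: "x \<in> {x \<in> ?V. v x \<noteq> 0}" "y \<in> {x \<in> ?V. v x \<noteq> 0}"
          and "card (?E `` {x}) = card (?E `` {y})"
        then have "card (?F `` {x}) = card (?F `` {y})" using nbr fin by simp
        then show "x = y" using inj_onD[OF inj] xy by simp
      qed
      show "(\<Sum>x\<in>?V. v x) = 0" using sum vu simple(1) u by simp
    qed
    with vu show ?thesis by simp
  qed
qed

text \<open>
  Of two nodes, one dominates the other: the relation is decided when the later of the two is added,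
  and nodes added afterwards are adjacent to both or to neither.
\<close>

lemma threshold_nested:
  assumes "threshold_graph G"
  shows "parcs G `` {x} - {y} \<subseteq> parcs G `` {y} \<or> parcs G `` {y} - {x} \<subseteq> parcs G `` {x}"
  using assms
proof induction
  case (single v)
  then show ?case by simp
next
  case (add_isolated G u)
  then show ?case by simp
next
  case (add_dominating G u)
  have "parcs G \<subseteq> pverts G \<times> pverts G" by (rule threshold_graph_simple[OF add_dominating.hyps(1)])
  with add_dominating show ?case by auto
qed

text \<open>Nested sets of the same finite size are equal.\<close>

lemma threshold_twins:
  assumes G: "threshold_graph G" and deg: "card (parcs G `` {x}) = card (parcs G `` {y})"
  shows "parcs G `` {x} - {y} = parcs G `` {y} - {x}"
proof -
  note simple = threshold_graph_simple[OF G]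
  have fin: "finite (parcs G `` {z})" for z
    using simple(1,2) by (rule finite_neighbours)
  have "y \<in> parcs G `` {x} \<longleftrightarrow> x \<in> parcs G `` {y}" using simple(3) by (auto dest: symD)
  then have card: "card (parcs G `` {x} - {y}) = card (parcs G `` {y} - {x})"
    using deg fin by (simp add: card_Diff_singleton_if)
  have "x \<notin> parcs G `` {x}" "y \<notin> parcs G `` {y}" using simple(4) by (auto simp: irrefl_def)
  then have "parcs G `` {x} - {y} \<subseteq> parcs G `` {y} - {x} \<or> parcs G `` {y} - {x} \<subseteq> parcs G `` {x} - {y}"
    using threshold_nested[OF G, of x y] by auto
  then show ?thesis using card fin card_subset_eq by (metis finite_Diff)
qed

text \<open>
  The eigenvalue is the common degree, increased by one if the twins \<open>x\<close> and \<open>y\<close> are adjacent.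
\<close>

lemma lap_twins:
  fixes x y :: 'a
  assumes G: "threshold_graph G" and deg: "card (parcs G `` {x}) = card (parcs G `` {y})"
    and "x \<noteq> y"
  defines "v \<equiv> (\<lambda>z. of_bool (z = x) - of_bool (z = y) :: 'b :: comm_ring_1)"
  shows "lap (parcs G) v i = (of_nat (card (parcs G `` {x})) + of_bool ((x, y) \<in> parcs G)) * v i"
proof -
  let ?N = "\<lambda>z. parcs G `` {z}"
  note simple = threshold_graph_simple[OF G]
  have fin: "finite (?N z)" for z
    using simple(1,2) by (rule finite_neighbours)
  have sym: "(a, b) \<in> parcs G \<longleftrightarrow> (b, a) \<in> parcs G" for a b using simple(3) by (auto dest: symD)
  have irr: "(a, a) \<notin> parcs G" for a using simple(4) by (auto simp: irrefl_def)
  have "lap (parcs G) v i = of_nat (card (?N i)) * v i - (\<Sum>j\<in>?N i. v j)"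
    by (simp add: lap_def sum_subtractf)
  also have "(\<Sum>j\<in>?N i. v j) = of_bool (x \<in> ?N i) - of_bool (y \<in> ?N i)"
    using fin by (simp add: v_def sum_subtractf of_bool_def)
  also have "of_nat (card (?N i)) * v i - (of_bool (x \<in> ?N i) - of_bool (y \<in> ?N i))
      = (of_nat (card (?N x)) + of_bool ((x, y) \<in> parcs G)) * v i"
  proof -
    consider "i = x" | "i = y" | "i \<noteq> x" "i \<noteq> y" by blast
    then show ?thesis
    proof cases
      case 1
      then show ?thesis using \<open>x \<noteq> y\<close> irr by (simp add: v_def)
    next
      case 2
      then show ?thesis using \<open>x \<noteq> y\<close> irr deg sym[of y x] by (simp add: v_def)
    next
      case 3
      then have "i \<in> ?N x \<longleftrightarrow> i \<in> ?N y" using threshold_twins[OF G deg] by blast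
      then have "x \<in> ?N i \<longleftrightarrow> y \<in> ?N i" using sym[of i x] sym[of i y] by simp
      then show ?thesis using 3 by (simp add: v_def)
    qed
  qed
  finally show ?thesis .
qed

lemma connected_no_isolated:
  assumes conn: "Digraph_Component.connected (with_proj G)" and sym: "sym (parcs G)"
    and xy: "x \<in> pverts G" "y \<in> pverts G" "x \<noteq> y"
  shows "parcs G `` {x} \<noteq> {}"
proof -
  have "arcs_ends (with_proj G) = parcs G" by (auto simp: arcs_ends_conv)
  moreover have "(parcs G)\<^sup>s = parcs G" using sym by (auto simp: symcl_def dest: symD)
  ultimately have "(x, y) \<in> rtrancl_on (pverts G) (parcs G)"
    using conn xy unfolding connected_conv by simp
  then have "(x, y) \<in> (parcs G)\<^sup>*" by (rule rtrancl_on_rtranclI)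
  then show ?thesis using xy(3) by (auto elim: converse_rtranclE)
qed

lemma deg_eq_card: "deg G x = card (parcs G `` {x})"
proof -
  have "out_arcs (with_proj G) x = Pair x ` (parcs G `` {x})" by (auto simp: out_arcs_def)
  then show ?thesis by (simp add: out_degree_def card_image inj_on_def)
qed

section \<open>Controllable sets of nodes\<close>

lemma minus_laplacian_mat_carrier: "- laplacian_mat n G \<in> carrier_mat n n"
  by (simp add: laplacian_mat_def degree_mat_def adjacency_mat_def minus_carrier_mat)

lemma minus_laplacian_mat_symmetric:
  assumes "sym (parcs G)"
  shows "(- laplacian_mat n G)\<^sup>T = - laplacian_mat n G"
  using assms by (intro eq_matI)
    (auto simp: laplacian_mat_def degree_mat_def adjacency_mat_def dest: symD)

lemma minus_laplacian_mat_apply: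
  fixes f :: "nat \<Rightarrow> 'b :: real_algebra_1"
  assumes V: "parcs G \<subseteq> {..<n} \<times> {..<n}" and i: "i < n"
  shows "(\<Sum>j<n. of_real ((- laplacian_mat n G) $$ (i, j)) * f j) = - lap (parcs G) f i"
proof -
  let ?N = "parcs G `` {i}"
  have N: "?N = {j \<in> {..<n}. (i, j) \<in> parcs G}" using V by auto
  have "of_real ((- laplacian_mat n G) $$ (i, j)) * f j
      = (if (i, j) \<in> parcs G then f j else 0) - (if j = i then of_nat (card ?N) * f j else 0)"
    if "j < n" for j
    using i that by (auto simp: laplacian_mat_def degree_mat_def adjacency_mat_def deg_eq_card algebra_simps)
  then have "(\<Sum>j<n. of_real ((- laplacian_mat n G) $$ (i, j)) * f j)
      = (\<Sum>j<n. if (i, j) \<in> parcs G then f j else 0) - of_nat (card ?N) * f i"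
    using i by (simp add: sum_subtractf)
  also have "(\<Sum>j<n. if (i, j) \<in> parcs G then f j else 0) = (\<Sum>j\<in>?N. f j)"
    unfolding N by (rule sum.inter_filter[symmetric]) simp
  finally show ?thesis by (simp add: lap_def sum_subtractf)
qed

text \<open>
  For two uncontrolled nodes \<open>x, y\<close> of equal degree, \<open>e_x - e_y\<close> and all its iterates, being its
  multiples, vanish on the control nodes.
\<close>

lemma controllable_imp_distinct_degrees:
  assumes G: "threshold_graph G" and V: "pverts G = {..<n}" and js: "set js \<subseteq> pverts G"
    and ctrl: "controllable n (- laplacian_mat n G) (input_mat n js)"
  shows "inj_on (deg G) (pverts G - set js)"
proof (rule inj_onI, rule ccontr)
  fix x y assume x: "x \<in> pverts G - set js" and y: "y \<in> pverts G - set js"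
    and "deg G x = deg G y" and "x \<noteq> y"
  note simple = threshold_graph_simple[OF G]
  define A where "A = - laplacian_mat n G"
  have A: "A \<in> carrier_mat n n" "A\<^sup>T = A"
    using minus_laplacian_mat_carrier minus_laplacian_mat_symmetric[OF simple(3)] by (auto simp: A_def)
  define v where "v = (\<lambda>z. of_bool (z = x) - of_bool (z = y) :: real)"
  define w where "w = vec n v"
  define l where "l = - (real (card (parcs G `` {x})) + of_bool ((x, y) \<in> parcs G))"
  have w: "w \<in> carrier_vec n" by (simp add: w_def)
  have Aw: "A *\<^sub>v w = l \<cdot>\<^sub>v w"
  proof (intro eq_vecI)
    fix i assume "i < dim_vec (l \<cdot>\<^sub>v w)"
    then have i: "i < n" using w by simp
    have "(A *\<^sub>v w) $ i = (\<Sum>j<n. of_real (A $$ (i, j)) * v j)"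
      using i A(1) by (simp add: scalar_prod_def w_def atLeast0LessThan)
    also have "\<dots> = - lap (parcs G) v i"
      unfolding A_def using minus_laplacian_mat_apply[OF _ i] simple(2) V by metis
    also have "lap (parcs G) v i = - l * v i"
      using lap_twins[OF G _ \<open>x \<noteq> y\<close>, where 'b = real, of i] \<open>deg G x = deg G y\<close>
      unfolding v_def l_def deg_eq_card by (simp only: minus_minus)
    finally show "(A *\<^sub>v w) $ i = (l \<cdot>\<^sub>v w) $ i" using i by (simp add: w_def)
  qed (use A w in simp)
  have pow: "(((*\<^sub>v) A) ^^ k) w = l ^ k \<cdot>\<^sub>v w" for k
  proof (induction k)
    case (Suc k)
    then show ?case using A(1) w Aw by (simp add: mult_mat_vec smult_smult_assoc mult.commute)
  qed simp
  have "w $ j = 0" if "j \<in> set js" for j using that js x y V by (auto simp: w_def v_def)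
  then have "\<forall>k<n. \<forall>j\<in>set js. ((((*\<^sub>v) A) ^^ k) w) $ j = 0"
    using js V w by (auto simp: pow)
  then have "w = 0\<^sub>v n"
    using ctrl controllable_symmetric_iff[OF A, of js] js V w by (auto simp: A_def)
  then have "w $ x = 0" using x V by simp
  then show False using x V \<open>x \<noteq> y\<close> by (simp add: w_def v_def)
qed

text \<open>
  The eigenvector extracted from an uncontrollable direction is supported on the uncontrolled nodes.
  Connectedness enters only for the eigenvalue \<open>0\<close>, where it excludes isolated nodes; for any other
  eigenvalue the coordinate sum vanishes because every value of the Laplacian has sum zero.
\<close>

lemma distinct_degrees_imp_controllable:
  assumes G: "threshold_graph G" and V: "pverts G = {..<n}" and n: "n \<ge> 2"
    and conn: "Digraph_Component.connected (with_proj G)"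
    and js: "set js \<subseteq> pverts G" and inj: "inj_on (deg G) (pverts G - set js)"
  shows "controllable n (- laplacian_mat n G) (input_mat n js)"
proof -
  note simple = threshold_graph_simple[OF G]
  define A where "A = - laplacian_mat n G"
  have A: "A \<in> carrier_mat n n" "A\<^sup>T = A"
    using minus_laplacian_mat_carrier minus_laplacian_mat_symmetric[OF simple(3)] by (auto simp: A_def)
  have "w = 0\<^sub>v n"
    if w: "w \<in> carrier_vec n" and zero: "\<forall>k<n. \<forall>j\<in>set js. ((((*\<^sub>v) A) ^^ k) w) $ j = 0" for w
  proof (rule ccontr)
    assume "w \<noteq> 0\<^sub>v n"
    then obtain i0 where i0: "i0 < n" "w $ i0 \<noteq> 0" using w by (auto simp: vec_eq_iff)
    define g where "g k i = complex_of_real (((((*\<^sub>v) A) ^^ k) w) $ i)" for k i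
    have it: "(((*\<^sub>v) A) ^^ k) w \<in> carrier_vec n" for k
      by (induction k) (use A w in auto)
    have step: "g (Suc k) i = (\<Sum>j<n. of_real (A $$ (i, j)) * g k j)" if "i < n" for k i
      using that it[of k] A(1) by (simp add: g_def scalar_prod_def atLeast0LessThan)
    have g0: "g 0 i0 \<noteq> 0" using i0 by (simp add: g_def)
    have "\<exists>l u. (\<exists>i<n. u i \<noteq> 0)
        \<and> (\<forall>i<n. (\<Sum>j<n. complex_of_real (A $$ (i, j)) * u j) = l * u i)
        \<and> (\<forall>i. (\<forall>k<n. g k i = 0) \<longrightarrow> u i = 0)"
      by (rule krylov_eigenvector[OF step i0(1) g0])
    then obtain l u where u: "\<exists>i<n. u i \<noteq> 0"
      and eig: "\<forall>i<n. (\<Sum>j<n. complex_of_real (A $$ (i, j)) * u j) = l * u i"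
      and uz: "\<forall>i. (\<forall>k<n. g k i = 0) \<longrightarrow> u i = 0"
      by blast
    have "u j = 0" if "j \<in> set js" for j using uz zero that by (simp add: g_def)
    then have inj': "inj_on (\<lambda>x. card (parcs G `` {x})) {x \<in> pverts G. u x \<noteq> 0}"
      using inj unfolding deg_eq_card by (elim inj_on_subset) auto
    have lap: "\<forall>i\<in>pverts G. lap (parcs G) u i = - l * u i"
    proof
      fix i assume "i \<in> pverts G"
      then have i: "i < n" using V by simp
      have "- lap (parcs G) u i = l * u i"
        using minus_laplacian_mat_apply[OF _ i, of G u] eig[rule_format, OF i] simple(2) V by (simp add: A_def)
      then show "lap (parcs G) u i = - l * u i" by (metis minus_minus mult_minus_left)
    qed
    have "u i = 0" if i: "i \<in> pverts G" for i
    proof (cases "l = 0")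
      case True
      have "parcs G `` {i} \<noteq> {}"
      proof -
        have "(if i = 0 then 1 else 0) \<in> pverts G" "i \<noteq> (if i = 0 then 1 else 0)" using V n by auto
        then show ?thesis using connected_no_isolated[OF conn simple(3) i] by blast
      qed
      then show ?thesis
        using lap_kernel_support_isolated[OF simple _ inj' i] lap True by auto
    next
      case False
      have "- l * (\<Sum>x\<in>pverts G. u x) = (\<Sum>x\<in>pverts G. lap (parcs G) u x)"
        using lap by (simp add: sum_distrib_left)
      then have "(\<Sum>x\<in>pverts G. u x) = 0" using sum_lap[OF simple(1-3)] False by simp
      then show ?thesis using threshold_eigenvector_zero[OF G lap inj'] i by blast
    qed
    with u V show False by auto
  qed
  then show ?thesis
    using controllable_symmetric_iff[OF A, of js] js V by (auto simp: A_def)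
qed

theorem theorem4:
  fixes G :: "nat pair_pre_digraph" and n s :: nat and d :: "nat \<Rightarrow> nat" and K :: "nat \<Rightarrow> nat set"
  assumes threshold: "threshold_graph G"
    and nodes: "pverts G = {..<n}"
    and size: "n \<ge> 2"
    and conn: "Digraph_Component.connected (with_proj G)"
    and s: "s = card (deg G ` pverts G)"
    and d_less: "strict_mono_on {1..s} d"
    and d_degrees: "d ` {1..s} = deg G ` pverts G"
    and K: "\<And>i. i \<in> {1..s} \<Longrightarrow> K i = {j \<in> pverts G. deg G j = d i}"
  shows
    "(\<forall>k VC js.
        (\<forall>i\<in>{1..s}. k i \<in> K i) \<and> VC = pverts G - k ` {1..s} \<and> distinct js \<and> set js = VC \<longrightarrow>
        controllable n (- laplacian_mat n G) (input_mat n js) \<and> card VC = n - s) \<and>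
     (\<exists>VC js. VC \<subseteq> pverts G \<and> distinct js \<and> set js = VC \<and>
        controllable n (- laplacian_mat n G) (input_mat n js) \<and> card VC = n - s) \<and>
     (\<forall>VC js. VC \<subseteq> pverts G \<and> distinct js \<and> set js = VC \<and>
        controllable n (- laplacian_mat n G) (input_mat n js) \<longrightarrow> n - s \<le> card VC)"
proof -
  have deg_k: "deg G (k i) = d i" "k i \<in> pverts G"
    if "\<forall>i\<in>{1..s}. k i \<in> K i" "i \<in> {1..s}" for k i
    using that K by auto
  have card_V: "card (pverts G) = n" using nodes by simp
  have finV: "finite (pverts G)" using nodes by simp
  have "inj_on d {1..s}" using d_less by (rule strict_mono_on_imp_inj_on)
  have transversal: "controllable n (- laplacian_mat n G) (input_mat n js) \<and> card VC = n - s"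
    if k: "\<forall>i\<in>{1..s}. k i \<in> K i" and VC: "VC = pverts G - k ` {1..s}" and js: "set js = VC"
    for k VC js
  proof
    have sub: "k ` {1..s} \<subseteq> pverts G" using deg_k[OF k] by auto
    have inj_deg: "inj_on (deg G \<circ> k) {1..s}"
    proof -
      have "inj_on (deg G \<circ> k) {1..s} \<longleftrightarrow> inj_on d {1..s}"
        using deg_k(1)[OF k] by (intro inj_on_cong) simp
      then show ?thesis using \<open>inj_on d {1..s}\<close> by blast
    qed
    then have inj: "inj_on k {1..s}" by (rule inj_on_imageI2)
    show "card VC = n - s"
      unfolding VC using sub card_V card_image[OF inj] finV by (subst card_Diff_subset) auto
    have "pverts G - set js = k ` {1..s}" using sub VC js by auto
    moreover have "inj_on (deg G) (k ` {1..s})" using inj_deg by (rule inj_on_imageI)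
    ultimately show "controllable n (- laplacian_mat n G) (input_mat n js)"
      using distinct_degrees_imp_controllable[OF threshold nodes size conn] js VC by simp
  qed
  have "\<exists>VC js. VC \<subseteq> pverts G \<and> distinct js \<and> set js = VC \<and>
      controllable n (- laplacian_mat n G) (input_mat n js) \<and> card VC = n - s"
  proof -
    have "\<exists>x. x \<in> K i" if "i \<in> {1..s}" for i
    proof -
      have "d i \<in> deg G ` pverts G" using that d_degrees by blast
      then show ?thesis using K[OF that] by auto
    qed
    then have k: "\<forall>i\<in>{1..s}. (SOME x. x \<in> K i) \<in> K i" by (simp add: some_in_eq ex_in_conv)
    define k where "k i = (SOME x. x \<in> K i)" for i
    have k: "\<forall>i\<in>{1..s}. k i \<in> K i" using k by (simp add: k_def)
    obtain js where "distinct js" "set js = pverts G - k ` {1..s}"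
      using finite_distinct_list[of "pverts G - k ` {1..s}"] finV by auto
    then show ?thesis using transversal[OF k refl] by blast
  qed
  moreover have "n - s \<le> card VC"
    if "VC \<subseteq> pverts G" "set js = VC" "controllable n (- laplacian_mat n G) (input_mat n js)" for VC js
  proof -
    have "inj_on (deg G) (pverts G - VC)"
      using controllable_imp_distinct_degrees[OF threshold nodes _ that(3)] that by simp
    then have "card (pverts G - VC) \<le> s"
      unfolding s using finV by (intro card_inj_on_le) auto
    then show ?thesis using that(1) finV card_V by (simp add: card_Diff_subset finite_subset)
  qed
  ultimately show ?thesis using transversal by blast
qed

end
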